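(* Assume $a>0$, $\sigma^2>0$, $z>0$, and $0<v_t\le v_s$. Fix $s<t$ and apply the same realized experiment (prices and demands at dates $s,\dots,t-1$) to every candidate posterior $N(m_s+v_sq,v_s)$. The natural displacement is invariant: the date-$t$ posterior mean of the candidate is $$m_t^q=m_t+v_tq,$$ and the date-$s$ family $\mathcal G_s(z)$ is inherited at date $t$ with raw (posterior-mean) radius $\rho_{s\to t}^I=zv_t/\sqrt{v_s}$, while the fresh family $\mathcal G_t(z)$ has raw radius $\rho_t^F=z\sqrt{v_t}$. Thus $v_t<v_s$ implies $\rho_t^F>\rho_{s\to t}^I$. For a $q$-budget $k\ge0$ put $d(k):=m_t+kv_t$. Worst-case (over $|q|\le k$) expected one-period revenue on the nonnegative price interval $[\underline p,\bar p]$ is $$\underline r(p;m_t,v_t,k)=ap-d(k)p^2,$$ and its unique constrained maximizer is $p^\star(d(k))$, where $$p^\star(d)=\begin{cases}\bar p,& d\le0,\\ \Pi_{[\underline p,\bar p]}\{a/(2d)\},& d>0.\end{cases}$$ The map $d\mapsto p^\star(d)$ is nonincreasing. For the inherited and fresh budgets $k_I=z/\sqrt{v_s}$ and $k_F=z/\sqrt{v_t}$, with optimal prices $p_{s,t}^I=p^\star(d(k_I))$ and $p_t^F=p^\star(d(k_F))$, $v_t<v_s$ gives $d(k_F)>d(k_I)$ and therefore $p_t^F\le p_{s,t}^I$. If $d(k_I)>0$, both objectives are strictly concave; equality then occurs exactly when the two projected optima coincide, and both optima being interior implies $p_t^F<p_{s,t}^I$. If $d(k_I)\le0$, then $p_{s,t}^I=\bar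 p$, with strict inequality $p_t^F<p_{s,t}^I$ precisely when $p_t^F<\bar p$. If every candidate posterior mean (for the fresh family) is to remain positive, the additional restriction is $m_t-k_Fv_t>0$; this restriction concerns the means and is not needed for the constrained quadratic maximization.
   Context: Linear-Gaussian demand: at price $p_t\in[\underline p,\bar p]$, $0\le\underline p<\bar p<\infty$, demand is $Y_{t+1}=a-\theta p_t+\varepsilon_{t+1}$ with $\varepsilon_{t+1}\sim N(0,\sigma^2)$ and $\theta\in\mathbb R$ unknown. If the belief at date $t$ is $\theta\sim N(m_t,v_t)$ with $v_t>0$, Bayesian updating gives $v_{t+1}^{-1}=v_t^{-1}+p_t^2/\sigma^2$ and $m_{t+1}=v_{t+1}\{m_t/v_t+p_t(a-Y_{t+1})/\sigma^2\}$; $(m_t,v_t)$ is the nominal posterior obtained from $(m_s,v_s)$. A candidate posterior at date $t$ with natural displacement $q$ is $N(m_t+v_tq,v_t)$. $\mathcal G_s(z):=\{N(m_s+v_sq,v_s):|q|\le z/\sqrt{v_s}\}$. One-period expected revenue at price $p$ under a candidate with displacement $q$ is $p\{a-p(m_t+v_tq)\}$. $\Pi_{[\underline p,\bar p]}$ is projection onto the interval. *)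

theory Defs
  imports "HOL-Probability.Probability"
begin

text \<open>Arguments named \<open>v\<close> and \<open>\<sigma>2\<close> are variances, whereas \<^const>\<open>normal_density\<close> takes
  a standard deviation.\<close>

definition gaussian :: "real \<Rightarrow> real \<Rightarrow> real measure" where
  "gaussian m v = density lborel (normal_density m (sqrt v))"

definition candidate :: "real \<Rightarrow> real \<Rightarrow> real \<Rightarrow> real measure" where
  "candidate m v q = gaussian (m + v * q) v"

definition candidate_family :: "real \<Rightarrow> real \<Rightarrow> real \<Rightarrow> real measure set" where
  "candidate_family m v k = candidate m v ` {q. \<bar>q\<bar> \<le> k}"

definition G_family :: "real \<Rightarrow> real \<Rightarrow> real \<Rightarrow> real measure set" where
  "G_family m v z = candidate_family m v (z / sqrt v)"

definition belief_mean :: "real measure \<Rightarrow> real" where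
  "belief_mean M = (LINT \<theta>|M. \<theta>)"

definition raw_radius :: "real \<Rightarrow> real measure set \<Rightarrow> real" where
  "raw_radius m F = (SUP M\<in>F. \<bar>belief_mean M - m\<bar>)"

text \<open>Demand is \<open>y = a - \<theta> * p + \<epsilon>\<close> with \<open>\<epsilon> \<sim> N(0, \<sigma>2)\<close>, so the likelihood of \<open>\<theta>\<close> is the shock
  density at the residual.\<close>

definition likelihood :: "real \<Rightarrow> real \<Rightarrow> real \<Rightarrow> real \<Rightarrow> real \<Rightarrow> real" where
  "likelihood a \<sigma>2 p y \<theta> = normal_density 0 (sqrt \<sigma>2) (y - (a - \<theta> * p))"

definition bayes_update :: "real \<Rightarrow> real \<Rightarrow> real \<Rightarrow> real \<Rightarrow> real measure \<Rightarrow> real measure" where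
  "bayes_update a \<sigma>2 p y M =
     density M (\<lambda>\<theta>. ennreal (likelihood a \<sigma>2 p y \<theta> / (LINT \<eta>|M. likelihood a \<sigma>2 p y \<eta>)))"

text \<open>The price charged at date \<open>i\<close> generates the demand \<open>Y (Suc i)\<close>; the experiment from \<open>s\<close> to \<open>t\<close>
  uses the prices at dates \<open>s, \<dots>, t - 1\<close>.\<close>

definition posterior_after ::
  "real \<Rightarrow> real \<Rightarrow> (nat \<Rightarrow> real) \<Rightarrow> (nat \<Rightarrow> real) \<Rightarrow> nat \<Rightarrow> nat \<Rightarrow> real measure \<Rightarrow> real measure" where
  "posterior_after a \<sigma>2 price Y s t M =
     fold (\<lambda>i. bayes_update a \<sigma>2 (price i) (Y (Suc i))) [s..<t] M"

text \<open>Expectation under independent \<open>\<theta> \<sim> M\<close> and \<open>\<epsilon> \<sim> N(0, \<sigma>2)\<close>.\<close>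

definition expected_revenue :: "real \<Rightarrow> real \<Rightarrow> real measure \<Rightarrow> real \<Rightarrow> real" where
  "expected_revenue a \<sigma>2 M p =
     (LINT x|(M \<Otimes>\<^sub>M gaussian 0 \<sigma>2). p * (a - fst x * p + snd x))"

definition worst_revenue :: "real \<Rightarrow> real \<Rightarrow> real measure set \<Rightarrow> real \<Rightarrow> real" where
  "worst_revenue a \<sigma>2 F p = (INF M\<in>F. expected_revenue a \<sigma>2 M p)"

definition worst_slope :: "real \<Rightarrow> real \<Rightarrow> real \<Rightarrow> real" where
  "worst_slope m v k = m + k * v"

definition pstar :: "real \<Rightarrow> real \<Rightarrow> real \<Rightarrow> real \<Rightarrow> real" where
  "pstar a pl pu d = (if d \<le> 0 then pu else closest_point {pl..pu} (a / (2 * d)))"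

definition unique_maximizer_on :: "real set \<Rightarrow> (real \<Rightarrow> real) \<Rightarrow> real \<Rightarrow> bool" where
  "unique_maximizer_on S f x \<longleftrightarrow> (\<forall>y. is_arg_max f (\<lambda>p. p \<in> S) y \<longleftrightarrow> y = x)"

definition strictly_concave_on :: "real set \<Rightarrow> (real \<Rightarrow> real) \<Rightarrow> bool" where
  "strictly_concave_on S f \<longleftrightarrow> convex S \<and>
     (\<forall>x\<in>S. \<forall>y\<in>S. \<forall>u. x \<noteq> y \<longrightarrow> 0 < u \<longrightarrow> u < 1 \<longrightarrow>
        (1 - u) * f x + u * f y < f ((1 - u) * x + u * y))"

end

theory Submission
  imports Defs
begin

text \<open>
  \<^bold>\<open>Invariance of the displacement.\<close> Write a Gaussian belief in natural parameters: precision
  \<open>1 / v\<close> and precision-weighted mean \<open>m / v\<close>. The log-likelihood of one observation is quadratic in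
  \<open>\<theta>\<close>, so Bayes' rule adds to these two parameters increments that depend on the price and the
  demand but not on the belief (\<open>bayes_update_gaussian\<close>). A candidate \<open>N(m + v q, v)\<close> has natural
  parameters \<open>(1 / v, m / v + q)\<close>: it is the nominal belief shifted by \<open>q\<close>, and adding the same
  increments to both keeps the shift (\<open>posterior_after_candidate\<close>). Hence the inherited family at
  date \<open>t\<close> is again a family of candidates, with its old budget \<open>z / sqrt (v s)\<close>, while the fresh one
  has budget \<open>z / sqrt (v t)\<close>. A budget \<open>k\<close> amounts to a radius \<open>k v\<close> for the means, so everything
  that distinguishes the two families comes from comparing two budgets at the same variance.

  \<^bold>\<open>Pricing.\<close> Expected revenue depends on the belief only through its mean and is nonincreasing in
  it, so at every price the worst case is the extreme displacement \<open>q = k\<close>, and the robust problem is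
  the maximization of one explicit quadratic \<open>a p - d p\<^sup>2\<close> (\<open>worst_revenue_candidate_family\<close>). Its
  constrained maximizer is the projection of the vertex \<open>a / (2 d)\<close>, or the upper end of the interval
  when \<open>d \<le> 0\<close> (\<open>pstar_unique_maximizer\<close>). A larger budget raises \<open>d\<close>, which
  moves the vertex to the left, and projection onto an interval is monotone (\<open>pstar_antimono\<close>);
  where the projection is inactive at both vertices the move is strict.
\<close>

section \<open>Gaussian beliefs and Bayesian updating\<close>

lemma prob_space_gaussian: "0 < v \<Longrightarrow> prob_space (gaussian m v)"
  unfolding gaussian_def by (rule prob_space_normal_density) simp

lemma sets_gaussian [measurable_cong]: "sets (gaussian m v) = sets borel"
  by (simp add: gaussian_def)

lemma has_bochner_integral_gaussian:
  assumes "0 < v"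
  shows "has_bochner_integral (gaussian m v) (\<lambda>x. x) m"
  unfolding gaussian_def
  using normal_moment_nz_1[of "sqrt v" m] assms
  by (intro has_bochner_integral_density) auto

lemma belief_mean_gaussian: "0 < v \<Longrightarrow> belief_mean (gaussian m v) = m"
  using has_bochner_integral_integral_eq[OF has_bochner_integral_gaussian]
  by (simp add: belief_mean_def)

lemma belief_mean_candidate: "0 < v \<Longrightarrow> belief_mean (candidate m v q) = m + v * q"
  by (simp add: candidate_def belief_mean_gaussian)

text \<open>Completing the square in \<open>\<theta>\<close>. The part \<open>K\<close> left over does not involve \<open>\<theta>\<close>; it is the
  predictive density of the observed demand, which is the normalizing constant of Bayes' rule.\<close>

lemma normal_density_mult_likelihood:
  assumes "0 < v" "0 < \<sigma>2" "0 < v'"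
    and prec: "inverse v' = inverse v + p\<^sup>2 / \<sigma>2"
    and mean: "m' = v' * (m / v + p * (a - y) / \<sigma>2)"
  obtains K where "0 < K"
    "\<And>\<theta>. normal_density m (sqrt v) \<theta> * likelihood a \<sigma>2 p y \<theta> = K * normal_density m' (sqrt v') \<theta>"
proof -
  \<comment> \<open>\<open>- C\<close> is the constant term of the completed square in the exponent.\<close>
  define C where "C = m\<^sup>2 / (2 * v) + (a - y)\<^sup>2 / (2 * \<sigma>2) - m'\<^sup>2 / (2 * v')"
  define K where "K = sqrt (2 * pi * v') / (sqrt (2 * pi * v) * sqrt (2 * pi * \<sigma>2)) * exp (- C)"
  have m': "m' / v' = m / v + p * (a - y) / \<sigma>2"
    using mean \<open>0 < v'\<close> by simp
  have square: "- (\<theta> - m)\<^sup>2 / (2 * v) + - (y - (a - \<theta> * p))\<^sup>2 / (2 * \<sigma>2)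
      = - C + - (\<theta> - m')\<^sup>2 / (2 * v')" for \<theta>
  proof -
    have "- (\<theta> - m)\<^sup>2 / (2 * v) + - (y - (a - \<theta> * p))\<^sup>2 / (2 * \<sigma>2)
        = - (\<theta>\<^sup>2 / 2) * (inverse v + p\<^sup>2 / \<sigma>2) + \<theta> * (m / v + p * (a - y) / \<sigma>2)
          - m\<^sup>2 / (2 * v) - (a - y)\<^sup>2 / (2 * \<sigma>2)"
      using assms(1,2) by (simp add: field_simps power2_eq_square)
    also have "\<dots> = - (\<theta>\<^sup>2 / 2) * inverse v' + \<theta> * (m' / v')
          - m\<^sup>2 / (2 * v) - (a - y)\<^sup>2 / (2 * \<sigma>2)"
      by (simp only: prec m')
    also have "\<dots> = - C + - (\<theta> - m')\<^sup>2 / (2 * v')"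
      using assms(3) by (simp add: C_def inverse_eq_divide power2_diff diff_divide_distrib
          add_divide_distrib)
    finally show ?thesis .
  qed
  have "normal_density m (sqrt v) \<theta> * likelihood a \<sigma>2 p y \<theta> = K * normal_density m' (sqrt v') \<theta>"
    for \<theta>
  proof -
    have "normal_density m (sqrt v) \<theta> * likelihood a \<sigma>2 p y \<theta>
        = 1 / (sqrt (2 * pi * v) * sqrt (2 * pi * \<sigma>2))
          * exp (- (\<theta> - m)\<^sup>2 / (2 * v) + - (y - (a - \<theta> * p))\<^sup>2 / (2 * \<sigma>2))"
      using assms(1,2) by (simp add: normal_density_def likelihood_def mult_exp_exp)
    also have "\<dots> = K * normal_density m' (sqrt v') \<theta>"
      unfolding square exp_add using assms(3) by (simp add: K_def normal_density_def)
    finally show ?thesis .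
  qed
  moreover have "0 < K"
    using assms(1-3) by (simp add: K_def)
  ultimately show thesis
    using that by blast
qed

lemma bayes_update_gaussian:
  assumes "0 < v" "0 < \<sigma>2" "0 < v'"
    and "inverse v' = inverse v + p\<^sup>2 / \<sigma>2"
    and "m' = v' * (m / v + p * (a - y) / \<sigma>2)"
  shows "bayes_update a \<sigma>2 p y (gaussian m v) = gaussian m' v'"
proof -
  obtain K where K: "0 < K" and
    prod: "\<And>\<theta>. normal_density m (sqrt v) \<theta> * likelihood a \<sigma>2 p y \<theta> = K * normal_density m' (sqrt v') \<theta>"
    using normal_density_mult_likelihood[OF assms] by metis
  have meas [measurable]: "likelihood a \<sigma>2 p y \<in> borel_measurable borel"
    unfolding likelihood_def[abs_def] normal_density_def by measurable
  have evidence: "(LINT \<eta>|gaussian m v. likelihood a \<sigma>2 p y \<eta>) = K"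
    using assms(3) by (simp add: gaussian_def integral_density prod)
  have "ennreal (normal_density m (sqrt v) \<theta>) * ennreal (likelihood a \<sigma>2 p y \<theta> / K)
      = ennreal (normal_density m' (sqrt v') \<theta>)" for \<theta>
    using K prod[of \<theta>] by (simp flip: ennreal_mult')
  then show ?thesis
    unfolding bayes_update_def evidence by (simp add: gaussian_def density_density_eq)
qed

text \<open>In natural coordinates the updating rule is additive: the prior enters the posterior through
  \<open>m / v\<close>, so the displacement \<open>q = (mean - m) / v\<close> passes through an update unchanged.\<close>

lemma bayes_update_candidate:
  assumes "0 < v" "0 < \<sigma>2" "0 < v'"
    and "inverse v' = inverse v + p\<^sup>2 / \<sigma>2"
    and "m' = v' * (m / v + p * (a - y) / \<sigma>2)"
  shows "bayes_update a \<sigma>2 p y (candidate m v q) = candidate m' v' q"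
  unfolding candidate_def
  using assms by (intro bayes_update_gaussian) (simp_all add: add_divide_distrib distrib_left)

text \<open>The recursion is stated for inverses, and \<open>inverse 0 = 0\<close>, so positivity of the later variances
  has to be derived: precisions can only grow.\<close>

lemma posterior_variance_pos:
  fixes v :: "nat \<Rightarrow> real"
  assumes "s \<le> t" "0 < v s" "0 < \<sigma>2"
    and "\<forall>i\<in>{s..<t}. inverse (v (Suc i)) = inverse (v i) + (price i)\<^sup>2 / \<sigma>2"
  shows "0 < v t"
  using assms(1,4)
proof (induction t rule: dec_induct)
  case base
  show ?case using assms(2) .
next
  case (step n)
  then have "0 < inverse (v n) + (price n)\<^sup>2 / \<sigma>2"
    using assms(3) by (intro add_pos_nonneg) auto
  then show ?case
    using step by (simp flip: inverse_positive_iff_positive[of "v (Suc n)"])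
qed

lemma posterior_after_candidate:
  fixes v :: "nat \<Rightarrow> real"
  assumes "s \<le> t" "0 < v s" "0 < \<sigma>2"
    and "\<forall>i\<in>{s..<t}. inverse (v (Suc i)) = inverse (v i) + (price i)\<^sup>2 / \<sigma>2"
    and "\<forall>i\<in>{s..<t}. m (Suc i) = v (Suc i) * (m i / v i + price i * (a - Y (Suc i)) / \<sigma>2)"
  shows "posterior_after a \<sigma>2 price Y s t (candidate (m s) (v s) q) = candidate (m t) (v t) q"
  using assms(1,4,5)
proof (induction t rule: dec_induct)
  case base
  show ?case by (simp add: posterior_after_def)
next
  case (step n)
  have "0 < v n" "0 < v (Suc n)"
    using step by (auto intro!: posterior_variance_pos[where v = v and s = s and price = price, OF _ assms(2,3)])
  then have "bayes_update a \<sigma>2 (price n) (Y (Suc n)) (candidate (m n) (v n) q)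
      = candidate (m (Suc n)) (v (Suc n)) q"
    using step.hyps step.prems assms(3) by (intro bayes_update_candidate) auto
  then show ?case
    using step by (simp add: posterior_after_def)
qed

section \<open>Families of candidates\<close>

lemma candidate_family_eq_gaussians:
  assumes "0 < v"
  shows "candidate_family m v k = {gaussian \<mu> v |\<mu>. \<bar>\<mu> - m\<bar> \<le> k * v}" (is "_ = ?R")
proof (intro equalityI subsetI)
  fix M assume "M \<in> candidate_family m v k"
  then obtain q where "M = gaussian (m + v * q) v" "\<bar>q\<bar> \<le> k"
    by (auto simp: candidate_family_def candidate_def)
  moreover from this have "\<bar>m + v * q - m\<bar> \<le> k * v"
    using assms by (simp add: abs_mult mult.commute)
  ultimately show "M \<in> ?R" by blast
next
  fix M assume "M \<in> ?R"
  then obtain \<mu> where \<mu>: "M = gaussian \<mu> v" "\<bar>\<mu> - m\<bar> \<le> k * v" by blast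
  then have "M = candidate m v ((\<mu> - m) / v)" "\<bar>(\<mu> - m) / v\<bar> \<le> k"
    using assms by (auto simp: candidate_def abs_divide divide_le_eq)
  then show "M \<in> candidate_family m v k"
    by (auto simp: candidate_family_def)
qed

lemma raw_radius_candidate_family:
  assumes "0 < v" "0 \<le> k"
  shows "raw_radius m (candidate_family m v k) = k * v"
  unfolding raw_radius_def
proof (rule cSup_eq_maximum)
  have "candidate m v k \<in> candidate_family m v k"
    using assms by (simp add: candidate_family_def)
  moreover have "\<bar>belief_mean (candidate m v k) - m\<bar> = k * v"
    using assms by (simp add: belief_mean_candidate abs_mult)
  ultimately show "k * v \<in> (\<lambda>M. \<bar>belief_mean M - m\<bar>) ` candidate_family m v k"
    by (metis image_eqI)
next
  fix x assume "x \<in> (\<lambda>M. \<bar>belief_mean M - m\<bar>) ` candidate_family m v k"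
  then show "x \<le> k * v"
    using assms by (auto simp: candidate_family_eq_gaussians belief_mean_gaussian)
qed

lemma belief_means_pos_iff:
  assumes "0 < v" "0 \<le> k"
  shows "(\<forall>M\<in>candidate_family m v k. 0 < belief_mean M) \<longleftrightarrow> 0 < m - k * v"
proof
  assume "\<forall>M\<in>candidate_family m v k. 0 < belief_mean M"
  moreover have "candidate m v (- k) \<in> candidate_family m v k"
    using assms by (simp add: candidate_family_def)
  ultimately have "0 < belief_mean (candidate m v (- k))" by blast
  then show "0 < m - k * v"
    using assms by (simp add: belief_mean_candidate mult.commute)
next
  assume "0 < m - k * v"
  then show "\<forall>M\<in>candidate_family m v k. 0 < belief_mean M"
    using assms by (auto simp: candidate_family_eq_gaussians belief_mean_gaussian)
qed

section \<open>Worst-case revenue\<close>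

text \<open>The shock has mean zero and enters additively, so no other feature of the belief than its mean
  survives integration.\<close>

lemma expected_revenue_eq:
  assumes "prob_space M" "sets M = sets borel" "integrable M (\<lambda>\<theta>. \<theta>)" "0 < \<sigma>2"
  shows "expected_revenue a \<sigma>2 M p = p * (a - p * belief_mean M)"
proof -
  let ?N = "gaussian 0 \<sigma>2"
  interpret M: prob_space M by fact
  interpret N: prob_space ?N using assms(4) by (rule prob_space_gaussian)
  interpret P: pair_prob_space M ?N ..
  note [measurable_cong] = assms(2)
  have N: "integrable ?N (\<lambda>x. x)" "(LINT x|?N. x) = 0"
    using has_bochner_integral_gaussian[OF assms(4), of 0] by (auto simp: has_bochner_integral_iff)
  have fst: "integrable (M \<Otimes>\<^sub>M ?N) (\<lambda>x. fst x)"
    using assms(3) N.distr_pair_fst[of M] integrable_distr[of fst "M \<Otimes>\<^sub>M ?N" M "\<lambda>x. x"] by simp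
  \<comment> \<open>The second marginal is the first marginal of the swapped product.\<close>
  have "integrable (?N \<Otimes>\<^sub>M M) (\<lambda>x. fst x)"
    using N(1) M.distr_pair_fst[of ?N] integrable_distr[of fst "?N \<Otimes>\<^sub>M M" ?N "\<lambda>x. x"] by simp
  then have snd: "integrable (M \<Otimes>\<^sub>M ?N) (\<lambda>x. snd x)"
    using P.integrable_product_swap_iff[of "\<lambda>x. snd x"] by (simp add: case_prod_beta')
  have "expected_revenue a \<sigma>2 M p = (LINT \<theta>|M. LINT e|?N. p * (a - \<theta> * p + e))"
    unfolding expected_revenue_def using fst snd
    by (subst P.integral_fst'[symmetric]) auto
  also have "\<dots> = (LINT \<theta>|M. p * (a - \<theta> * p))"
    using N by (simp add: N.prob_space)
  also have "\<dots> = p * (a - p * belief_mean M)"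
    using assms(3) by (simp add: belief_mean_def M.prob_space mult.commute)
  finally show ?thesis .
qed

lemma expected_revenue_candidate:
  assumes "0 < v" "0 < \<sigma>2"
  shows "expected_revenue a \<sigma>2 (candidate m v q) p = p * (a - p * (m + v * q))"
proof -
  have "integrable (candidate m v q) (\<lambda>\<theta>. \<theta>)"
    using has_bochner_integral_gaussian[OF assms(1)] by (auto simp: candidate_def has_bochner_integral_iff)
  then show ?thesis
    using assms expected_revenue_eq[of "candidate m v q"]
    by (simp add: belief_mean_candidate) (simp add: candidate_def prob_space_gaussian sets_gaussian)
qed

text \<open>Revenue depends on \<open>q\<close> through \<open>- p\<^sup>2 * v * q\<close>, so the steepest demand curve, at
  \<open>q = k\<close>, is a worst case whatever the price.\<close>

lemma worst_revenue_candidate_family: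
  assumes "0 < v" "0 < \<sigma>2" "0 \<le> k"
  shows "worst_revenue a \<sigma>2 (candidate_family m v k) p = a * p - worst_slope m v k * p\<^sup>2"
  unfolding worst_revenue_def
proof (rule cInf_eq_minimum)
  have "expected_revenue a \<sigma>2 (candidate m v k) p = a * p - worst_slope m v k * p\<^sup>2"
    using assms by (simp add: expected_revenue_candidate worst_slope_def algebra_simps power2_eq_square)
  moreover have "candidate m v k \<in> candidate_family m v k"
    using assms by (simp add: candidate_family_def)
  ultimately show "a * p - worst_slope m v k * p\<^sup>2
      \<in> (\<lambda>M. expected_revenue a \<sigma>2 M p) ` candidate_family m v k"
    by (metis image_eqI)
next
  fix x assume "x \<in> (\<lambda>M. expected_revenue a \<sigma>2 M p) ` candidate_family m v k"
  then obtain q where q: "\<bar>q\<bar> \<le> k" and x: "x = p * (a - p * (m + v * q))"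
    using assms by (auto simp: candidate_family_def expected_revenue_candidate)
  have "p\<^sup>2 * (v * q) \<le> p\<^sup>2 * (v * k)"
    using q assms by (intro mult_left_mono) auto
  then show "a * p - worst_slope m v k * p\<^sup>2 \<le> x"
    by (simp add: x worst_slope_def algebra_simps power2_eq_square)
qed

section \<open>The quadratic pricing problem\<close>

lemma closest_point_atLeastAtMost:
  fixes l u x :: real
  assumes "l \<le> u"
  shows "closest_point {l..u} x = max l (min u x)"
  using assms by (intro closest_point_unique[symmetric]) (auto simp: dist_real_def)

lemma unique_maximizer_onI:
  assumes "x \<in> S" "\<And>y. y \<in> S \<Longrightarrow> y \<noteq> x \<Longrightarrow> f y < f x"
  shows "unique_maximizer_on S f x"
  unfolding unique_maximizer_on_def is_arg_max_def
  using assms by (metis less_asym)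

text \<open>For \<open>d > 0\<close> the objective equals \<open>a\<^sup>2 / (4 * d) - d * (p - a / (2 * d))\<^sup>2\<close>, so maximizing it is the
  same as minimizing the distance to the vertex \<open>a / (2 * d)\<close>. For \<open>d \<le> 0\<close> it is strictly
  increasing on nonnegative prices.\<close>

lemma pstar_unique_maximizer:
  assumes "0 < a" "0 \<le> pl" "pl \<le> pu"
  shows "unique_maximizer_on {pl..pu} (\<lambda>p. a * p - d * p\<^sup>2) (pstar a pl pu d)"
proof (cases "d \<le> 0")
  case True
  have "a * y - d * y\<^sup>2 < a * pu - d * pu\<^sup>2" if "y \<in> {pl..pu}" "y \<noteq> pu" for y
  proof -
    have "a * y < a * pu" using assms that by simp
    moreover have "d * pu\<^sup>2 \<le> d * y\<^sup>2"
      using True assms that by (intro mult_left_mono_neg power_mono) auto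
    ultimately show ?thesis by linarith
  qed
  then show ?thesis
    using True assms by (intro unique_maximizer_onI) (auto simp: pstar_def)
next
  case False
  define vertex where "vertex = a / (2 * d)"
  define c where "c = closest_point {pl..pu} vertex"
  have obj: "a * p - d * p\<^sup>2 = d * vertex\<^sup>2 - d * (p - vertex)\<^sup>2" for p
    using False by (simp add: vertex_def field_simps power2_eq_square)
  have "d * (c - vertex)\<^sup>2 < d * (y - vertex)\<^sup>2" if "y \<in> {pl..pu}" "y \<noteq> c" for y
  proof -
    have "\<bar>c - vertex\<bar> < \<bar>y - vertex\<bar>"
      using closest_point_lt[of "{pl..pu}" y vertex] that
      by (simp add: c_def dist_real_def abs_minus_commute)
    then have "(c - vertex)\<^sup>2 < (y - vertex)\<^sup>2"
      using abs_le_square_iff[of "y - vertex" "c - vertex"] by linarith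
    then show ?thesis using False by simp
  qed
  moreover have "c \<in> {pl..pu}"
    unfolding c_def using assms by (intro closest_point_in_set) auto
  ultimately show ?thesis
    using False unfolding obj
    by (intro unique_maximizer_onI) (auto simp: pstar_def c_def vertex_def)
qed

text \<open>At \<open>d \<le> 0\<close> the price is already at the top of the interval, so only \<open>0 < d \<le> e\<close> needs the
  comparison of the two vertices.\<close>

lemma pstar_antimono:
  assumes "0 < a" "pl \<le> pu"
  shows "antimono (pstar a pl pu)"
proof (rule antimonoI)
  fix d e :: real assume "d \<le> e"
  show "pstar a pl pu e \<le> pstar a pl pu d"
  proof (cases "d \<le> 0")
    case True
    then show ?thesis using assms by (simp add: pstar_def closest_point_atLeastAtMost)
  next
    case False
    then have "a / (2 * e) \<le> a / (2 * d)"
      using assms \<open>d \<le> e\<close> by (intro divide_left_mono) auto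
    then show ?thesis
      using assms False \<open>d \<le> e\<close> by (auto simp: pstar_def closest_point_atLeastAtMost)
  qed
qed

lemma pstar_interior:
  assumes "pl \<le> pu" "0 < d" "pstar a pl pu d \<in> {pl<..<pu}"
  shows "pstar a pl pu d = a / (2 * d)"
  using assms by (auto simp: pstar_def closest_point_atLeastAtMost max_def min_def split: if_splits)

lemma strictly_concave_on_quadratic:
  fixes a d :: real
  assumes "convex S" "0 < d"
  shows "strictly_concave_on S (\<lambda>p. a * p - d * p\<^sup>2)"
  unfolding strictly_concave_on_def
proof (intro conjI ballI allI impI assms(1))
  fix x y u :: real assume "x \<noteq> y" "0 < u" "u < 1"
  \<comment> \<open>This is exactly the concavity gap of \<open>- d * p\<^sup>2\<close>; the linear part contributes nothing.\<close>
  then have "0 < d * (u * (1 - u) * (x - y)\<^sup>2)"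
    using assms(2) by (intro mult_pos_pos) auto
  also have "\<dots> = (a * ((1 - u) * x + u * y) - d * ((1 - u) * x + u * y)\<^sup>2)
      - ((1 - u) * (a * x - d * x\<^sup>2) + u * (a * y - d * y\<^sup>2))"
    by (simp add: algebra_simps power2_eq_square)
  finally show "(1 - u) * (a * x - d * x\<^sup>2) + u * (a * y - d * y\<^sup>2)
      < a * ((1 - u) * x + u * y) - d * ((1 - u) * x + u * y)\<^sup>2"
    by simp
qed

section \<open>Inherited against fresh ambiguity\<close>

theorem theorem9p1:
  fixes a \<sigma>2 z pl pu kI kF pI pF :: real
    and price Y m v :: "nat \<Rightarrow> real"
    and s t :: nat
    and inherited fresh :: "real measure set"
  assumes "0 < a" and "0 < \<sigma>2" and "0 < z"
    and "0 \<le> pl" and "pl < pu"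
    and "s < t"
    and "\<forall>i\<in>{s..<t}. price i \<in> {pl..pu}"
    and "\<forall>i\<in>{s..<t}. inverse (v (Suc i)) = inverse (v i) + (price i)\<^sup>2 / \<sigma>2"
    and "\<forall>i\<in>{s..<t}. m (Suc i) = v (Suc i) * (m i / v i + price i * (a - Y (Suc i)) / \<sigma>2)"
    and "0 < v t" and "v t \<le> v s"
    and "inherited = posterior_after a \<sigma>2 price Y s t ` G_family (m s) (v s) z"
    and "fresh = G_family (m t) (v t) z"
    and "kI = z / sqrt (v s)" and "kF = z / sqrt (v t)"
    and "pI = pstar a pl pu (worst_slope (m t) (v t) kI)"
    and "pF = pstar a pl pu (worst_slope (m t) (v t) kF)"
  shows
    "(\<forall>q. posterior_after a \<sigma>2 price Y s t (candidate (m s) (v s) q) = candidate (m t) (v t) q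
        \<and> belief_mean (posterior_after a \<sigma>2 price Y s t (candidate (m s) (v s) q)) = m t + v t * q)
     \<and> inherited = candidate_family (m t) (v t) kI
     \<and> inherited = {gaussian \<mu> (v t) |\<mu>. \<bar>\<mu> - m t\<bar> \<le> z * v t / sqrt (v s)}
     \<and> fresh = {gaussian \<mu> (v t) |\<mu>. \<bar>\<mu> - m t\<bar> \<le> z * sqrt (v t)}
     \<and> raw_radius (m t) inherited = z * v t / sqrt (v s)
     \<and> raw_radius (m t) fresh = z * sqrt (v t)
     \<and> (v t < v s \<longrightarrow> raw_radius (m t) inherited < raw_radius (m t) fresh)
     \<and> (\<forall>q p. expected_revenue a \<sigma>2 (candidate (m t) (v t) q) p = p * (a - p * (m t + v t * q)))
     \<and> (\<forall>k\<ge>0.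
          (\<forall>p\<in>{pl..pu}. worst_revenue a \<sigma>2 (candidate_family (m t) (v t) k) p
             = a * p - worst_slope (m t) (v t) k * p\<^sup>2)
          \<and> unique_maximizer_on {pl..pu} (worst_revenue a \<sigma>2 (candidate_family (m t) (v t) k))
              (pstar a pl pu (worst_slope (m t) (v t) k)))
     \<and> antimono (pstar a pl pu)
     \<and> unique_maximizer_on {pl..pu} (worst_revenue a \<sigma>2 inherited) pI
     \<and> unique_maximizer_on {pl..pu} (worst_revenue a \<sigma>2 fresh) pF
     \<and> (v t < v s \<longrightarrow>
          worst_slope (m t) (v t) kI < worst_slope (m t) (v t) kF \<and> pF \<le> pI)
     \<and> (worst_slope (m t) (v t) kI > 0 \<longrightarrow>
          strictly_concave_on {pl..pu} (worst_revenue a \<sigma>2 inherited)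
          \<and> strictly_concave_on {pl..pu} (worst_revenue a \<sigma>2 fresh)
          \<and> (pF = pI \<longleftrightarrow>
               closest_point {pl..pu} (a / (2 * worst_slope (m t) (v t) kF))
               = closest_point {pl..pu} (a / (2 * worst_slope (m t) (v t) kI)))
          \<and> (v t < v s \<longrightarrow> pF \<in> {pl<..<pu} \<longrightarrow> pI \<in> {pl<..<pu} \<longrightarrow> pF < pI))
     \<and> (worst_slope (m t) (v t) kI \<le> 0 \<longrightarrow> pI = pu \<and> (pF < pI \<longleftrightarrow> pF < pu))
     \<and> ((\<forall>M\<in>fresh. 0 < belief_mean M) \<longleftrightarrow> 0 < m t - kF * v t)"
proof -
  note a = \<open>0 < a\<close> and \<sigma>2 = \<open>0 < \<sigma>2\<close> and z = \<open>0 < z\<close> and pl = \<open>0 \<le> pl\<close>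
    and vt = \<open>0 < v t\<close>
  have vs: "0 < v s" using assms(10,11) by linarith
  have pu: "pl \<le> pu" and st: "s \<le> t" using assms(5,6) by auto
  let ?d = "worst_slope (m t) (v t)"
  have k: "0 \<le> kI" "0 \<le> kF" using z vs vt assms(14,15) by auto
  have vt_sqrt: "z * sqrt (v t) = kF * v t"
    using vt real_div_sqrt[of "v t"] by (simp add: assms(15) flip: times_divide_eq_right)
  have vs_sqrt: "z * v t / sqrt (v s) = kI * v t"
    by (simp add: assms(14))
  have post: "posterior_after a \<sigma>2 price Y s t (candidate (m s) (v s) q) = candidate (m t) (v t) q" for q
    using posterior_after_candidate[OF st vs \<sigma>2 assms(8,9)] .
  have inh: "inherited = candidate_family (m t) (v t) kI"
    by (simp add: assms(12,14) G_family_def candidate_family_def image_image post)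
  have fre: "fresh = candidate_family (m t) (v t) kF"
    by (simp add: assms(13,15) G_family_def)
  have k_le: "kI \<le> kF"
    unfolding assms(14,15) using z vt assms(11) by (intro divide_left_mono) auto
  have k_less: "kI < kF" if "v t < v s"
    unfolding assms(14,15) using z vt that by (intro divide_strict_left_mono) auto
  have d_le: "?d kI \<le> ?d kF"
    using k_le vt by (simp add: worst_slope_def)
  have d_less: "?d kI < ?d kF" if "v t < v s"
    using k_less[OF that] vt by (simp add: worst_slope_def)
  have worst: "worst_revenue a \<sigma>2 (candidate_family (m t) (v t) k) = (\<lambda>p. a * p - ?d k * p\<^sup>2)"
    if "0 \<le> k" for k
    using worst_revenue_candidate_family[OF vt \<sigma>2 that] by blast
  have maxi: "unique_maximizer_on {pl..pu} (worst_revenue a \<sigma>2 (candidate_family (m t) (v t) k))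
      (pstar a pl pu (?d k))" if "0 \<le> k" for k
    unfolding worst[OF that] using a pl pu by (rule pstar_unique_maximizer)
  have anti: "antimono (pstar a pl pu)" using a pu by (rule pstar_antimono)
  have pF_le: "pF \<le> pI"
    unfolding assms(16,17) using anti d_le by (rule antimonoD)
  have interior: "pF < pI" if "v t < v s" "0 < ?d kI" "pF \<in> {pl<..<pu}" "pI \<in> {pl<..<pu}"
  proof -
    have "pF = a / (2 * ?d kF)" "pI = a / (2 * ?d kI)"
      using that d_le pstar_interior[OF pu] unfolding assms(16,17) by auto
    moreover have "a / (2 * ?d kF) < a / (2 * ?d kI)"
      using that(2) d_less[OF that(1)] a by (intro divide_strict_left_mono) auto
    ultimately show ?thesis by simp
  qed
  have concave: "strictly_concave_on {pl..pu} (worst_revenue a \<sigma>2 (candidate_family (m t) (v t) k))"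
    if "0 \<le> k" "0 < ?d k" for k
    unfolding worst[OF that(1)] using that(2) by (intro strictly_concave_on_quadratic) auto
  show ?thesis
  proof (intro conjI allI impI ballI)
    show "belief_mean (posterior_after a \<sigma>2 price Y s t (candidate (m s) (v s) q)) = m t + v t * q" for q
      by (simp add: post belief_mean_candidate vt)
    show "inherited = {gaussian \<mu> (v t) |\<mu>. \<bar>\<mu> - m t\<bar> \<le> z * v t / sqrt (v s)}"
      unfolding inh vs_sqrt by (rule candidate_family_eq_gaussians[OF vt])
    show "fresh = {gaussian \<mu> (v t) |\<mu>. \<bar>\<mu> - m t\<bar> \<le> z * sqrt (v t)}"
      unfolding fre vt_sqrt by (rule candidate_family_eq_gaussians[OF vt])
    show "raw_radius (m t) inherited = z * v t / sqrt (v s)"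
      unfolding inh vs_sqrt using vt k(1) by (rule raw_radius_candidate_family)
    show "raw_radius (m t) fresh = z * sqrt (v t)"
      unfolding fre vt_sqrt using vt k(2) by (rule raw_radius_candidate_family)
    show "raw_radius (m t) inherited < raw_radius (m t) fresh" if "v t < v s"
      using k_less[OF that] vt k by (simp add: inh fre raw_radius_candidate_family)
    show "expected_revenue a \<sigma>2 (candidate (m t) (v t) q) p = p * (a - p * (m t + v t * q))" for q p
      using vt \<sigma>2 by (rule expected_revenue_candidate)
    show "unique_maximizer_on {pl..pu} (worst_revenue a \<sigma>2 inherited) pI"
      unfolding inh assms(16) by (rule maxi[OF k(1)])
    show "unique_maximizer_on {pl..pu} (worst_revenue a \<sigma>2 fresh) pF"
      unfolding fre assms(17) by (rule maxi[OF k(2)])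
    show "(\<forall>M\<in>fresh. 0 < belief_mean M) \<longleftrightarrow> 0 < m t - kF * v t"
      unfolding fre using vt k(2) by (rule belief_means_pos_iff)
    show "(pF = pI) = (closest_point {pl..pu} (a / (2 * ?d kF)) = closest_point {pl..pu} (a / (2 * ?d kI)))"
      if "0 < ?d kI"
      using that d_le by (simp add: assms(16,17) pstar_def)
    show pI_eq: "pI = pu" if "?d kI \<le> 0" using that by (simp add: assms(16) pstar_def)
    show "(pF < pI) = (pF < pu)" if "?d kI \<le> 0" using pI_eq[OF that] by simp
    show "strictly_concave_on {pl..pu} (worst_revenue a \<sigma>2 inherited)" if "0 < ?d kI"
      unfolding inh using concave[OF k(1) that] .
    show "strictly_concave_on {pl..pu} (worst_revenue a \<sigma>2 fresh)" if "0 < ?d kI"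
      unfolding fre using concave[OF k(2)] that d_le by simp
  qed (use post inh worst maxi anti d_less pF_le interior in auto)
qed

end
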